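(* For any integers $n, d \geq 2$, any $\delta \in (0, e^{-1})$ and any $P \in \mathcal{P}_d$, with probability at least $1-8\delta$ under $P$ one has $$M_n \leq U_n \leq \frac{336\, s_{n/112}^\circ(P) + 2500\, e\, \log(1/\delta)}{n} .$$
   Context: $\mathcal{P}_d$ is the set of probability vectors $P=(p_1,\dots,p_d)$ (with $p_j\ge 0$, $\sum_j p_j=1$), identified with probability distributions on $\{1,\dots,d\}$. $X_1,\dots,X_n$ are i.i.d. with distribution $P$ and $N_j=\sum_{i=1}^n \mathbf{1}(X_i=j)$. The missing mass is $M_n=\sum_{j=1}^d p_j\mathbf{1}(N_j=0)$ and the underestimated mass is $U_n=\sum_{j=1}^d p_j\mathbf{1}(N_j\le np_j/4)$. For real $m>0$, $s_m^\circ(P)=\sum_{j=1}^d \min(e^{1-mp_j}, mp_j)=\sum_{j:\,p_j\ge 1/m}e^{1-mp_j}+\sum_{j:\,p_j<1/m} mp_j$. $\log$ is the natural logarithm and $e=\exp(1)$. *)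

theory Defs
  imports "HOL-Probability.Probability"
begin

(* Vectors of length d are functions on nat; only their values on {1..d} matter. *)
definition prob_vectors :: "nat \<Rightarrow> (nat \<Rightarrow> real) set" where
  "prob_vectors d = {P. (\<forall>j\<in>{1..d}. 0 \<le> P j) \<and> (\<Sum>j\<in>{1..d}. P j) = 1}"

definition occurrences :: "nat \<Rightarrow> (nat \<Rightarrow> 'a \<Rightarrow> nat) \<Rightarrow> nat \<Rightarrow> 'a \<Rightarrow> nat" where
  "occurrences n X j \<omega> = (\<Sum>i\<in>{1..n}. of_bool (X i \<omega> = j))"

definition missing_mass ::
    "nat \<Rightarrow> nat \<Rightarrow> (nat \<Rightarrow> real) \<Rightarrow> (nat \<Rightarrow> 'a \<Rightarrow> nat) \<Rightarrow> 'a \<Rightarrow> real" where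
  "missing_mass d n P X \<omega> = (\<Sum>j\<in>{1..d}. P j * of_bool (occurrences n X j \<omega> = 0))"

definition underestimated_mass ::
    "nat \<Rightarrow> nat \<Rightarrow> (nat \<Rightarrow> real) \<Rightarrow> (nat \<Rightarrow> 'a \<Rightarrow> nat) \<Rightarrow> 'a \<Rightarrow> real" where
  "underestimated_mass d n P X \<omega> =
     (\<Sum>j\<in>{1..d}. P j * of_bool (real (occurrences n X j \<omega>) \<le> real n * P j / 4))"

definition s_circ :: "nat \<Rightarrow> real \<Rightarrow> (nat \<Rightarrow> real) \<Rightarrow> real" where
  "s_circ d m P = (\<Sum>j\<in>{1..d}. min (exp (1 - m * P j)) (m * P j))"

end

theory Submission
  imports Defs
begin

text \<open>
  Write $Z_j = \mathbf{1}(N_j \le n p_j / 4)$ and bound the exponential moment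
  $E \exp(\frac{n}{112} U_n) = E \prod_j (1 + c_j Z_j)$ with $c_j = e^{n p_j / 112} - 1 \ge 0$.
  Expanding the product over subsets $S$, negative association is not needed: since
  $Z_j \le e^{n p_j / 4 - N_j}$ and $\sum_{j \in S} N_j$ is a sum of $n$ independent indicators of mean
  $P(S)$, one gets $E \prod_{j \in S} Z_j \le \prod_{j \in S} e^{- n p_j (3/4 - 1/e)}$,
  and resumming yields the moment bound. The theorem is then Markov's inequality together with
  $(e^{x/112} - 1) e^{-x/4} \le \min (e^{1 - x/112}, x/112)$ for $x \ge 0$.
\<close>

lemma measurable_occurrences:
  assumes "\<And>i. i \<in> {1..n} \<Longrightarrow> X i \<in> measurable M (count_space A)"
  shows "occurrences n X j \<in> measurable M (count_space UNIV)"
proof -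
  have "(\<lambda>\<omega>. of_bool (X i \<omega> = j) :: nat) \<in> measurable M (count_space UNIV)" if "i \<in> {1..n}" for i
    using measurable_compose[OF assms[OF that], of "\<lambda>x. of_bool (x = j) :: nat" "count_space UNIV"]
    by simp
  then show ?thesis
    unfolding occurrences_def[abs_def] by measurable
qed

text \<open>Each sample contributes to the count of at most one index in \<open>S\<close>. This
  turns a sum of dependent counts into a sum over samples, to which independence of the
  \<open>X i\<close> applies.\<close>

lemma sum_occurrences:
  assumes "finite S"
  shows "(\<Sum>j\<in>S. real (occurrences n X j \<omega>)) = (\<Sum>i\<in>{1..n}. of_bool (X i \<omega> \<in> S))"
proof -
  have "(\<Sum>j\<in>S. real (occurrences n X j \<omega>)) = (\<Sum>i\<in>{1..n}. \<Sum>j\<in>S. of_bool (X i \<omega> = j))"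
    unfolding occurrences_def of_nat_sum of_nat_of_bool by (rule sum.swap)
  also have "\<dots> = (\<Sum>i\<in>{1..n}. of_bool (X i \<omega> \<in> S))"
    using assms by (intro sum.cong refl) (simp add: of_bool_def)
  finally show ?thesis .
qed

text \<open>The exponential is affine in the indicator, so the expectation is exactly
  \<open>1 - (1 - exp (- 1)) * sum P S\<close>; then 1 + x <= e^x applies.\<close>

lemma (in prob_space) expectation_exp_neg_hit_le:
  assumes P: "P \<in> prob_vectors d" and S: "S \<subseteq> {1..d}"
    and Y: "distributed M (count_space {1..d}) Y (\<lambda>j. ennreal (P j))"
  shows "expectation (\<lambda>\<omega>. exp (- of_bool (Y \<omega> \<in> S))) \<le> exp (- ((1 - exp (- 1)) * sum P S))"
proof -
  have "expectation (\<lambda>\<omega>. exp (- of_bool (Y \<omega> \<in> S)))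
      = (\<integral>x. P x * exp (- of_bool (x \<in> S)) \<partial>count_space {1..d})"
    using P by (intro distributed_integral[OF Y, symmetric]) (auto simp: prob_vectors_def)
  also have "\<dots> = (\<Sum>x\<in>{1..d}. P x * exp (- of_bool (x \<in> S)))"
    by (simp add: lebesgue_integral_count_space_finite)
  also have "\<dots> = (\<Sum>x\<in>{1..d}. P x - (1 - exp (- 1)) * (if x \<in> S then P x else 0))"
    by (intro sum.cong) (auto simp: algebra_simps)
  also have "\<dots> = 1 - (1 - exp (- 1)) * (\<Sum>x\<in>{1..d}. if x \<in> S then P x else 0)"
    using P by (simp add: sum_subtractf sum_distrib_left prob_vectors_def)
  also have "(\<Sum>x\<in>{1..d}. if x \<in> S then P x else 0) = sum P S"
    using S by (simp add: sum.If_cases Int_absorb1)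
  also have "1 - (1 - exp (- 1)) * sum P S \<le> exp (- ((1 - exp (- 1)) * sum P S))"
    using exp_ge_add_one_self[of "- ((1 - exp (- 1)) * sum P S)"] by simp
  finally show ?thesis .
qed

text \<open>A Chernoff bound with parameter 1, applied to all indices of \<open>S\<close> at once.
  The rate 3/4 - 1/e is (1 - 1/e) - 1/4: the decay per sample less the cost of the
  threshold.\<close>

lemma (in prob_space) joint_underestimation_le:
  assumes P: "P \<in> prob_vectors d" and S: "S \<subseteq> {1..d}"
    and indep: "indep_vars (\<lambda>_. count_space {1..d}) X {1..n}"
    and X: "\<And>i. i \<in> {1..n} \<Longrightarrow> distributed M (count_space {1..d}) (X i) (\<lambda>j. ennreal (P j))"
  shows "expectation (\<lambda>\<omega>. \<Prod>j\<in>S. of_bool (real (occurrences n X j \<omega>) \<le> real n * P j / 4))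
           \<le> (\<Prod>j\<in>S. exp (- (real n * P j * (3 / 4 - exp (- 1)))))"
proof -
  have fin: "finite S"
    using S finite_subset by auto
  have X_meas: "X i \<in> measurable M (count_space {1..d})" if "i \<in> {1..n}" for i
    using X[OF that] by (simp add: distributed_def)
  let ?h = "\<lambda>i \<omega>. exp (- of_bool (X i \<omega> \<in> S)) :: real"
  have h_indep: "indep_vars (\<lambda>_. borel) ?h {1..n}"
    by (rule indep_vars_compose2[OF indep]) simp
  then have h_meas: "?h i \<in> borel_measurable M" if "i \<in> {1..n}" for i
    using that by (auto simp: indep_vars_def)
  have h_int: "integrable M (?h i)" if "i \<in> {1..n}" for i
    using h_meas[OF that] by (intro integrable_const_bound[where B = 1]) auto
  note h = finite_atLeastAtMost h_indep h_int
  have pointwise: "(\<Prod>j\<in>S. of_bool (real (occurrences n X j \<omega>) \<le> real n * P j / 4))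
      \<le> exp (real n * sum P S / 4) * (\<Prod>i\<in>{1..n}. ?h i \<omega>)" for \<omega>
  proof -
    \<comment> \<open>The indicator of a <= b is at most e^(b - a).\<close>
    have "(\<Prod>j\<in>S. of_bool (real (occurrences n X j \<omega>) \<le> real n * P j / 4))
        \<le> (\<Prod>j\<in>S. exp (real n * P j / 4 - real (occurrences n X j \<omega>)))"
      by (intro prod_mono) auto
    also have "\<dots> = exp (real n * sum P S / 4 - (\<Sum>j\<in>S. real (occurrences n X j \<omega>)))"
      using fin by (simp add: exp_sum[symmetric] sum_subtractf sum_distrib_left sum_divide_distrib)
    also have "\<dots> = exp (real n * sum P S / 4) * exp (\<Sum>i\<in>{1..n}. - of_bool (X i \<omega> \<in> S))"
      by (simp only: sum_occurrences[OF fin] sum_negf exp_add[symmetric] diff_conv_add_uminus)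
    also have "exp (\<Sum>i\<in>{1..n}. - of_bool (X i \<omega> \<in> S) :: real) = (\<Prod>i\<in>{1..n}. ?h i \<omega>)"
      by (rule exp_sum) simp
    finally show ?thesis .
  qed
  have "expectation (\<lambda>\<omega>. \<Prod>j\<in>S. of_bool (real (occurrences n X j \<omega>) \<le> real n * P j / 4))
      \<le> expectation (\<lambda>\<omega>. exp (real n * sum P S / 4) * (\<Prod>i\<in>{1..n}. ?h i \<omega>))"
    using indep_vars_integrable[OF h] pointwise
    by (intro integral_mono_AE') (auto intro!: AE_I2 mult_nonneg_nonneg prod_nonneg)
  also have "\<dots> = exp (real n * sum P S / 4) * (\<Prod>i\<in>{1..n}. expectation (?h i))"
    by (simp only: integral_mult_right_zero indep_vars_lebesgue_integral[OF h])
  also have "(\<Prod>i\<in>{1..n}. expectation (?h i))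
      \<le> (\<Prod>i\<in>{1..n}. exp (- ((1 - exp (- 1)) * sum P S)))"
    using expectation_exp_neg_hit_le[OF P S X] by (intro prod_mono) auto
  also have "exp (real n * sum P S / 4) * (\<Prod>i\<in>{1..n}. exp (- ((1 - exp (- 1)) * sum P S)))
      = exp (- (real n * sum P S * (3 / 4 - exp (- 1))))"
    by (simp add: exp_of_nat_mult[symmetric] exp_add[symmetric] algebra_simps)
  \<comment> \<open>The exponent is linear in \<open>sum P S\<close>, so the joint bound splits into
    one factor per index, as if the events were independent.\<close>
  also have "\<dots> = (\<Prod>j\<in>S. exp (- (real n * P j * (3 / 4 - exp (- 1)))))"
    using fin by (simp add: exp_sum[symmetric] sum_negf sum_distrib_left sum_distrib_right)
  finally show ?thesis
    by simp
qed

lemma prod_one_plus_eq_sum_Pow: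
  fixes f :: "'b \<Rightarrow> 'c :: comm_semiring_1"
  assumes "finite A"
  shows "(\<Prod>x\<in>A. 1 + f x) = (\<Sum>S\<in>Pow A. \<Prod>x\<in>S. f x)"
  using prod_add[OF assms, of f "\<lambda>_. 1"] by (simp add: add.commute)

text \<open>The expansion into subset products has nonnegative coefficients because every
  \<open>a j\<close> is nonnegative. Hence the joint bounds can be inserted term by term, and their
  product form lets the sum over subsets be folded back.\<close>

lemma (in prob_space) exponential_moment_underestimation_le:
  fixes a :: "nat \<Rightarrow> real"
  assumes P: "P \<in> prob_vectors d" and a: "\<And>j. j \<in> {1..d} \<Longrightarrow> 0 \<le> a j"
    and indep: "indep_vars (\<lambda>_. count_space {1..d}) X {1..n}"
    and X: "\<And>i. i \<in> {1..n} \<Longrightarrow> distributed M (count_space {1..d}) (X i) (\<lambda>j. ennreal (P j))"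
  defines "Z \<equiv> \<lambda>j \<omega>. of_bool (real (occurrences n X j \<omega>) \<le> real n * P j / 4) :: real"
  shows "expectation (\<lambda>\<omega>. exp (\<Sum>j\<in>{1..d}. a j * Z j \<omega>))
           \<le> exp (\<Sum>j\<in>{1..d}. (exp (a j) - 1) * exp (- (real n * P j * (3 / 4 - exp (- 1)))))"
proof -
  define c where "c j = exp (a j) - 1" for j
  let ?q = "\<lambda>j. exp (- (real n * P j * (3 / 4 - exp (- 1))))"
  have c: "0 \<le> c j" if "j \<in> {1..d}" for j
    using a[OF that] by (simp add: c_def)
  have Z_meas [measurable]: "Z j \<in> borel_measurable M" for j
  proof -
    have "occurrences n X j \<in> measurable M (count_space UNIV)"
      using X by (intro measurable_occurrences) (auto simp: distributed_def)
    from measurable_compose[OF this, of _ borel] show ?thesis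
      unfolding Z_def by simp
  qed
  have Z_int: "integrable M (\<lambda>\<omega>. \<Prod>j\<in>S. Z j \<omega>)" for S
  proof (rule integrable_const_bound[where B = 1])
    have "norm (\<Prod>j\<in>S. Z j \<omega>) \<le> 1" for \<omega>
      unfolding real_norm_def abs_prod by (intro prod_le_1) (simp add: Z_def)
    then show "AE \<omega> in M. norm (\<Prod>j\<in>S. Z j \<omega>) \<le> 1"
      by simp
  qed measurable
  have expand: "exp (\<Sum>j\<in>{1..d}. a j * Z j \<omega>) = (\<Sum>S\<in>Pow {1..d}. (\<Prod>j\<in>S. c j) * (\<Prod>j\<in>S. Z j \<omega>))" for \<omega>
  proof -
    \<comment> \<open>\<open>Z j\<close> takes only the values 0 and 1, so exp (a Z) = 1 + (exp a -
      1) Z is an identity.\<close>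
    have "exp (\<Sum>j\<in>{1..d}. a j * Z j \<omega>) = (\<Prod>j\<in>{1..d}. 1 + c j * Z j \<omega>)"
      unfolding exp_sum[OF finite_atLeastAtMost] by (intro prod.cong) (auto simp: Z_def c_def)
    then show ?thesis
      by (simp add: prod_one_plus_eq_sum_Pow prod.distrib)
  qed
  have "expectation (\<lambda>\<omega>. exp (\<Sum>j\<in>{1..d}. a j * Z j \<omega>))
      = (\<Sum>S\<in>Pow {1..d}. (\<Prod>j\<in>S. c j) * expectation (\<lambda>\<omega>. \<Prod>j\<in>S. Z j \<omega>))"
    unfolding expand using Z_int by simp
  also have "\<dots> \<le> (\<Sum>S\<in>Pow {1..d}. (\<Prod>j\<in>S. c j) * (\<Prod>j\<in>S. ?q j))"
    unfolding Z_def using joint_underestimation_le[OF P _ indep X] c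
    by (intro sum_mono mult_left_mono prod_nonneg) auto
  also have "\<dots> = (\<Prod>j\<in>{1..d}. 1 + c j * ?q j)"
    by (simp add: prod_one_plus_eq_sum_Pow prod.distrib)
  \<comment> \<open>Again 1 + x <= e^x, now in each factor.\<close>
  also have "\<dots> \<le> (\<Prod>j\<in>{1..d}. exp (c j * ?q j))"
    using c by (intro prod_mono) (auto intro!: add_nonneg_nonneg)
  also have "\<dots> = exp (\<Sum>j\<in>{1..d}. c j * ?q j)"
    by (simp add: exp_sum)
  finally show ?thesis
    by (simp add: c_def)
qed

text \<open>With x = n p_j the right side is the summand of \<open>s_circ\<close> at m = n/112. The
  first bound holds because 2/112 <= 1/4, the second because e^y - 1 <= y e^y and the factor
  e^(x/112 - x/4) is at most 1.\<close>

lemma exp_minus_one_times_exp_le_min: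
  fixes x :: real
  assumes "0 \<le> x"
  shows "(exp (x / 112) - 1) * exp (- (x * (3 / 4 - exp (- 1)))) \<le> min (exp (1 - x / 112)) (x / 112)"
proof -
  \<comment> \<open>The crude bound e >= 2 already makes the rate 3/4 - 1/e at least 1/4.\<close>
  have "exp (- 1) \<le> (1 / 2 :: real)"
    using exp_ge_add_one_self[of 1] by (simp add: exp_minus field_simps)
  then have "x * (1 / 4) \<le> x * (3 / 4 - exp (- 1))"
    using assms by (intro mult_left_mono) auto
  then have decay: "exp (- (x * (3 / 4 - exp (- 1)))) \<le> exp (- (x / 4))"
    by simp
  \<comment> \<open>This is 1 - y <= e^(-y) multiplied by e^y, at y = x/112.\<close>
  have growth: "exp (x / 112) - 1 \<le> x / 112 * exp (x / 112)"
    using mult_right_mono[OF exp_ge_add_one_self[of "- (x / 112)"], of "exp (x / 112)"]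
    by (simp add: exp_minus algebra_simps)
  have "(exp (x / 112) - 1) * exp (- (x * (3 / 4 - exp (- 1)))) \<le> exp (x / 112) * exp (- (x / 4))"
    using decay by (intro mult_mono) auto
  also have "\<dots> \<le> exp (1 - x / 112)"
    using assms by (simp add: exp_add[symmetric])
  finally have 1: "(exp (x / 112) - 1) * exp (- (x * (3 / 4 - exp (- 1)))) \<le> exp (1 - x / 112)" .
  have "(exp (x / 112) - 1) * exp (- (x * (3 / 4 - exp (- 1))))
      \<le> (x / 112 * exp (x / 112)) * exp (- (x / 4))"
    using decay growth assms by (intro mult_mono) auto
  also have "\<dots> = x / 112 * exp (x / 112 - x / 4)"
    by (simp only: mult.assoc exp_add[symmetric] diff_conv_add_uminus)
  also have "\<dots> \<le> x / 112"
    using assms by (intro mult_left_le) auto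
  finally show ?thesis
    using 1 by simp
qed

text \<open>An unseen index has count 0, which lies below the threshold n p_j / 4 since p_j >= 0.
  The inequality holds at every outcome.\<close>

lemma missing_mass_le_underestimated_mass:
  assumes "P \<in> prob_vectors d"
  shows "missing_mass d n P X \<omega> \<le> underestimated_mass d n P X \<omega>"
  unfolding missing_mass_def underestimated_mass_def using assms
  by (intro sum_mono mult_left_mono) (auto simp: prob_vectors_def)

theorem theorem6:
  fixes M :: "'a measure" and X :: "nat \<Rightarrow> 'a \<Rightarrow> nat"
    and P :: "nat \<Rightarrow> real" and n d :: nat and \<delta> :: real
  assumes "n \<ge> 2" and "d \<ge> 2"
    and "0 < \<delta>" and "\<delta> < exp (- 1)"
    and "P \<in> prob_vectors d"
    and "prob_space M"
    and "prob_space.indep_vars M (\<lambda>_. count_space {1..d}) X {1..n}"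
    and "\<And>i. i \<in> {1..n} \<Longrightarrow> distributed M (count_space {1..d}) (X i) (\<lambda>j. ennreal (P j))"
  shows "measure M {\<omega> \<in> space M.
           missing_mass d n P X \<omega> \<le> underestimated_mass d n P X \<omega> \<and>
           underestimated_mass d n P X \<omega>
             \<le> (336 * s_circ d (real n / 112) P + 2500 * exp 1 * ln (1 / \<delta>)) / real n}
         \<ge> 1 - 8 * \<delta>"
proof -
  interpret prob_space M by fact
  let ?U = "underestimated_mass d n P X"
  let ?s = "s_circ d (real n / 112) P"
  define t where "t = (336 * ?s + 2500 * exp 1 * ln (1 / \<delta>)) / real n"
  \<comment> \<open>The Chernoff parameter: \<open>l * P j\<close> is x/112 for x = n p_j, which
    matches the scalar inequality above.\<close>
  define l where "l = real n / 112"
  have n: "0 < real n"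
    using \<open>n \<ge> 2\<close> by simp
  have P: "0 \<le> P j" if "j \<in> {1..d}" for j
    using assms(5) that by (auto simp: prob_vectors_def)
  have U_meas [measurable]: "?U \<in> borel_measurable M"
  proof -
    have [measurable]: "occurrences n X j \<in> measurable M (count_space UNIV)" for j
      using assms(8) by (intro measurable_occurrences) (auto simp: distributed_def)
    show ?thesis
      unfolding underestimated_mass_def[abs_def] by measurable
  qed
  have s_nonneg: "0 \<le> ?s"
    unfolding s_circ_def using P by (intro sum_nonneg) auto
  have l_U: "l * ?U \<omega> = (\<Sum>j\<in>{1..d}. l * P j * of_bool (real (occurrences n X j \<omega>) \<le> real n * P j / 4))"
    for \<omega>
    by (simp only: underestimated_mass_def sum_distrib_left mult.assoc)
  \<comment> \<open>Boundedness of \<open>?U\<close> is what makes its exponential moment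
    integrable.\<close>
  have U_le: "?U \<omega> \<le> 1" for \<omega>
  proof -
    have "?U \<omega> \<le> (\<Sum>j\<in>{1..d}. P j)"
      unfolding underestimated_mass_def using P by (intro sum_mono) auto
    then show ?thesis
      using assms(5) by (simp add: prob_vectors_def)
  qed
  have int: "integrable M (\<lambda>\<omega>. exp (l * ?U \<omega>))"
  proof (rule integrable_const_bound[where B = "exp l"])
    show "AE \<omega> in M. norm (exp (l * ?U \<omega>)) \<le> exp l"
      using U_le n by (auto simp: l_def mult_left_le)
  qed simp
  have "expectation (\<lambda>\<omega>. exp (l * ?U \<omega>))
      \<le> exp (\<Sum>j\<in>{1..d}. (exp (l * P j) - 1) * exp (- (real n * P j * (3 / 4 - exp (- 1)))))"
    unfolding l_U using P n
    by (intro exponential_moment_underestimation_le assms) (auto simp: l_def)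
  also have "\<dots> \<le> exp ?s"
    unfolding s_circ_def exp_le_cancel_iff
  proof (intro sum_mono)
    fix j assume "j \<in> {1..d}"
    then show "(exp (l * P j) - 1) * exp (- (real n * P j * (3 / 4 - exp (- 1))))
        \<le> min (exp (1 - real n / 112 * P j)) (real n / 112 * P j)"
      using exp_minus_one_times_exp_le_min[of "real n * P j"] P n by (simp add: l_def)
  qed
  finally have moment: "expectation (\<lambda>\<omega>. exp (l * ?U \<omega>)) \<le> exp ?s" .
  have "ln (1 / \<delta>) > 0"
    using assms(3,4) by (simp add: ln_div order_less_le_trans[OF assms(4)])
  \<comment> \<open>Multiplying \<open>t\<close> by \<open>l\<close> divides the constants by 112:
    the coefficient of \<open>?s\<close> becomes 336/112 = 3 and that of the logarithm 2500 e / 112.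
    Both are at least 1, which is all that \<open>l_t\<close> uses.\<close>
  moreover have "112 \<le> 2500 * exp (1 :: real)"
    using exp_ge_add_one_self[of 1] by linarith
  ultimately have "112 * ln (1 / \<delta>) \<le> 2500 * exp 1 * ln (1 / \<delta>)"
    by (intro mult_right_mono) auto
  moreover have "l * t = (336 * ?s + 2500 * exp 1 * ln (1 / \<delta>)) / 112"
    using n by (simp add: l_def t_def)
  ultimately have l_t: "?s + ln (1 / \<delta>) \<le> l * t"
    using s_nonneg by simp
  have "prob {\<omega> \<in> space M. t < ?U \<omega>} \<le> prob {\<omega> \<in> space M. exp (l * t) \<le> exp (l * ?U \<omega>)}"
    using n by (intro finite_measure_mono) (auto simp: l_def)
  also have "\<dots> \<le> expectation (\<lambda>\<omega>. exp (l * ?U \<omega>)) / exp (l * t)"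
    by (rule integral_Markov_inequality_measure[OF int sets.top]) auto
  \<comment> \<open>The factor exp \<open>?s\<close> cancels, leaving failure probability at most
    \<delta>, well within the allowed 8 \<delta>.\<close>
  also have "\<dots> \<le> exp ?s / exp (?s + ln (1 / \<delta>))"
    using moment l_t by (intro frac_le) auto
  also have "\<dots> = \<delta>"
    using assms(3) by (simp add: exp_add)
  finally have "prob {\<omega> \<in> space M. t < ?U \<omega>} \<le> \<delta>" .
  moreover have "prob {\<omega> \<in> space M. \<not> t < ?U \<omega>} = 1 - prob {\<omega> \<in> space M. t < ?U \<omega>}"
    by (rule prob_neg) measurable
  \<comment> \<open>The first conjunct is true at every outcome, so the event is the complement of
    the upper tail.\<close>
  moreover have "{\<omega> \<in> space M. missing_mass d n P X \<omega> \<le> ?U \<omega> \<and> ?U \<omega> \<le> t}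
      = {\<omega> \<in> space M. \<not> t < ?U \<omega>}"
    using missing_mass_le_underestimated_mass[OF assms(5)] by auto
  ultimately show ?thesis
    using assms(3) unfolding t_def by simp
qed

end
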